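(* Let $b=b(n)\ge 1$ be an integer-valued function that is subpolynomial in $n$. Then, as $n\to\infty$, $$\tau(\mathcal{C}_n,b)=(1+o(1))\log_{b+1}(n),$$ where $\mathcal{C}_n$ is the hypergraph with vertex set $E(K_n)$ whose hyperedges are the edge sets of all spanning trees of $K_n$.
   Context: A function $f(n)$ is subpolynomial in $n$ if $f(n)=o(n^{\varepsilon})$ for all $\varepsilon>0$. Multistage $(1:b)$ Maker-Breaker game on a hypergraph $\mathcal{H}=(\mathcal{X},\mathcal{F})$ (board $\mathcal{X}$, family of winning sets $\mathcal{F}$), $b\ge 1$ an integer: Put $\mathcal{X}_0:=\mathcal{X}$, $\mathcal{F}_0:=\mathcal{F}$. For $i\ge 1$, in Stage $i$ Maker and Breaker play on the board $\mathcal{X}_{i-1}$, alternating in turns in which Maker claims exactly one unclaimed element of $\mathcal{X}_{i-1}$ and afterwards Breaker claims up to $b$ unclaimed elements of $\mathcal{X}_{i-1}$, with Maker moving first. Once all elements of $\mathcal{X}_{i-1}$ have been distributed among the players, $\mathcal{X}_i\subseteq\mathcal{X}_{i-1}$ denotes the set of all elements claimed by Maker in Stage $i$, and $\mathcal{F}_i:=\{F\in\mathcal{F}_{i-1}: F\subseteq\mathcal{X}_i\}$. The game stops the first time no winning sets are left. The threshold parameter $\tau(\mathcal{H},b)$ is the largest number $s$ such that Maker has a strategy (against every play of Breaker) ensuring $\mathcal{F}_s\neq\varnothing$. *)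

theory Defs
  imports "HOL-Analysis.Analysis" "HOL-Library.Landau_Symbols"
begin

section \<open>The multistage Maker-Breaker game\<close>

type_synonym 'a hypergraph = "'a set \<times> 'a set set"

text \<open>
  A round \<open>(m, B)\<close> records the element \<open>m\<close> claimed by Maker and the set \<open>B\<close> of
  elements that Breaker claims in reply; a stage is the list of its rounds, and a game is the
  list of its stages, in chronological order.
\<close>

type_synonym 'a stage = "('a \<times> 'a set) list"

definition maker_set :: "'a stage \<Rightarrow> 'a set" where
  "maker_set rs = fst ` set rs"

definition unclaimed :: "'a set \<Rightarrow> 'a stage \<Rightarrow> 'a set" where
  "unclaimed X rs = X - (\<Union>(m, B)\<in>set rs. insert m B)"

text \<open>Breaker may claim fewer than \<open>b\<close> elements, possibly none.\<close>

definition legal_rounds :: "nat \<Rightarrow> 'a set \<Rightarrow> 'a stage \<Rightarrow> bool" where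
  "legal_rounds b X rs \<longleftrightarrow>
     (\<forall>j<length rs. \<forall>m B. rs ! j = (m, B) \<longrightarrow>
        m \<in> unclaimed X (take j rs) \<and>
        B \<subseteq> unclaimed X (take j rs) - {m} \<and> finite B \<and> card B \<le> b)"

definition complete_stage :: "nat \<Rightarrow> 'a set \<Rightarrow> 'a stage \<Rightarrow> bool" where
  "complete_stage b X rs \<longleftrightarrow> legal_rounds b X rs \<and> unclaimed X rs = {}"

text \<open>For a game \<open>ps\<close> of \<open>i\<close> stages, \<open>board_after X ps\<close> is $\mathcal{X}_i$ and
  \<open>winning_after F ps\<close> is $\mathcal{F}_i$.\<close>

fun board_after :: "'a set \<Rightarrow> 'a stage list \<Rightarrow> 'a set" where
  "board_after X [] = X"
| "board_after X (p # ps) = board_after (maker_set p) ps"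

fun winning_after :: "'a set set \<Rightarrow> 'a stage list \<Rightarrow> 'a set set" where
  "winning_after F [] = F"
| "winning_after F (p # ps) = winning_after {A \<in> F. A \<subseteq> maker_set p} ps"

text \<open>
  Play is formally allowed to continue when no winning set is left. This does not matter, since
  $\mathcal{F}_i = \emptyset$ implies $\mathcal{F}_j = \emptyset$ for all $j \ge i$.
\<close>

fun legal_game :: "nat \<Rightarrow> 'a set \<Rightarrow> 'a stage list \<Rightarrow> bool" where
  "legal_game b X [] \<longleftrightarrow> True"
| "legal_game b X (p # ps) \<longleftrightarrow> complete_stage b X p \<and> legal_game b (maker_set p) ps"

text \<open>
  A strategy \<open>\<sigma>\<close> maps the completed stages and the rounds played so far in the current stage to
  Maker's next claim. Requiring \<open>\<sigma>\<close> to name an unclaimed element at every position where one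
  exists excludes strategies that would win vacuously because they admit no legal play.
\<close>

type_synonym 'a strategy = "'a stage list \<Rightarrow> 'a stage \<Rightarrow> 'a"

definition maker_strategy :: "nat \<Rightarrow> 'a set \<Rightarrow> 'a strategy \<Rightarrow> bool" where
  "maker_strategy b X \<sigma> \<longleftrightarrow>
     (\<forall>ps rs. legal_game b X ps \<longrightarrow> legal_rounds b (board_after X ps) rs \<longrightarrow>
        unclaimed (board_after X ps) rs \<noteq> {} \<longrightarrow>
        \<sigma> ps rs \<in> unclaimed (board_after X ps) rs)"

definition follows :: "'a strategy \<Rightarrow> 'a stage list \<Rightarrow> bool" where
  "follows \<sigma> ps \<longleftrightarrow>
     (\<forall>i<length ps. \<forall>j<length (ps ! i). fst (ps ! i ! j) = \<sigma> (take i ps) (take j (ps ! i)))"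

definition maker_survives :: "'a hypergraph \<Rightarrow> nat \<Rightarrow> nat \<Rightarrow> bool" where
  "maker_survives H b s \<longleftrightarrow>
     (\<exists>\<sigma>. maker_strategy b (fst H) \<sigma> \<and>
        (\<forall>ps. length ps = s \<longrightarrow> legal_game b (fst H) ps \<longrightarrow> follows \<sigma> ps \<longrightarrow>
           winning_after (snd H) ps \<noteq> {}))"

text \<open>
  The value is meaningful only if a largest such \<open>s\<close> exists. For a finite board and
  \<open>b \<ge> 1\<close> this is the case as soon as winning sets exist and each has at least two elements.
\<close>

definition tau :: "'a hypergraph \<Rightarrow> nat \<Rightarrow> nat" where
  "tau H b = (GREATEST s. maker_survives H b s)"


section \<open>Spanning trees of the complete graph\<close>

text \<open>
  An undirected edge is the two-element set of its ends. The trees of the AFP entry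
  Graph\_Theory are not used: there, acyclicity refers to directed cycles only.
\<close>

definition connected_on :: "'v set \<Rightarrow> 'v set set \<Rightarrow> bool" where
  "connected_on V E \<longleftrightarrow> V \<noteq> {} \<and> (\<forall>u\<in>V. \<forall>v\<in>V. (u, v) \<in> {(x, y). {x, y} \<in> E}\<^sup>*)"

definition is_cycle :: "'v set set \<Rightarrow> 'v list \<Rightarrow> bool" where
  "is_cycle E vs \<longleftrightarrow> length vs \<ge> 3 \<and> distinct vs \<and>
     (\<forall>i<length vs. {vs ! i, vs ! (Suc i mod length vs)} \<in> E)"

definition spanning_tree :: "'v set \<Rightarrow> 'v set set \<Rightarrow> 'v set set \<Rightarrow> bool" where
  "spanning_tree V E T \<longleftrightarrow> T \<subseteq> E \<and> connected_on V T \<and> (\<nexists>vs. is_cycle T vs)"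

definition complete_edges :: "nat \<Rightarrow> nat set set" where
  "complete_edges n = {e. e \<subseteq> {..<n} \<and> card e = 2}"

definition connectivity_hypergraph :: "nat \<Rightarrow> nat set hypergraph" where
  "connectivity_hypergraph n =
     (complete_edges n, {T. spanning_tree {..<n} (complete_edges n) T})"


section \<open>Asymptotics\<close>

definition subpolynomial :: "(nat \<Rightarrow> real) \<Rightarrow> bool" where
  "subpolynomial f \<longleftrightarrow> (\<forall>\<epsilon>>0. f \<in> o(\<lambda>n. real n powr \<epsilon>))"

end

theory Submission
  imports Defs "HOL-Real_Asymp.Real_Asymp"
begin

text \<open>
  Breaker, always claiming as many elements as allowed, turns a board of size \<open>m\<close> into one of size
  \<open>m'\<close> with \<open>(m' - 1) (b + 1) \<le> m - 1\<close>. As a connected graph on \<open>n\<close> vertices has at least \<open>n / 2\<close>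
  edges, Maker survives \<open>s\<close> stages only if \<open>(b + 1)\<^sup>s \<le> n + 1\<close>.

  Maker keeps every cut large. For a vertex set \<open>S\<close>, of whose cut Maker and Breaker hold \<open>M\<close> and
  \<open>B\<close> edges, the potential \<open>n\<^bsup>-|S|\<^esup> (1 - \<nu>)\<^bsup>M\<^esup> (1 + \<nu>)\<^bsup>B/b\<^esup>\<close> summed over all \<open>S\<close> is at most \<open>e\<close> at
  the beginning, and it does not increase if Maker always claims the edge for which the potentials of
  the cuts containing it have the largest sum. Hence in each stage every cut retains at least a
  fraction \<open>(1 - 4\<nu>) / (b + 1)\<close> of its edges, as long as the cuts have at least \<open>2 |S| b ln n / \<nu>\<^sup>2\<close>
  edges. They start with at least \<open>|S| n / 2\<close> edges, and the loss from all factors \<open>1 - 4\<nu>\<close> is an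
  arbitrarily small power of \<open>n\<close>, as is \<open>b\<close>, so this lasts for \<open>(1 - \<epsilon>) log\<^bsub>b+1\<^esub> n\<close> stages.
\<close>

section \<open>Plays\<close>

definition breaker_set :: "'a stage \<Rightarrow> 'a set" where
  "breaker_set rs = \<Union>(snd ` set rs)"

lemma maker_set_Nil [simp]: "maker_set [] = {}"
  and breaker_set_Nil [simp]: "breaker_set [] = {}"
  and maker_set_snoc [simp]: "maker_set (rs @ [(m, B)]) = insert m (maker_set rs)"
  and breaker_set_snoc [simp]: "breaker_set (rs @ [(m, B)]) = B \<union> breaker_set rs"
  by (auto simp: maker_set_def breaker_set_def)

lemma unclaimed_eq: "unclaimed X rs = X - maker_set rs - breaker_set rs"
  by (force simp: unclaimed_def maker_set_def breaker_set_def)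

lemma legal_rounds_Nil [simp]: "legal_rounds b X []"
  by (simp add: legal_rounds_def)

lemma legal_rounds_snoc:
  "legal_rounds b X (rs @ [(m, B)]) \<longleftrightarrow> legal_rounds b X rs \<and>
     m \<in> unclaimed X rs \<and> B \<subseteq> unclaimed X rs - {m} \<and> finite B \<and> card B \<le> b"
  by (auto simp: legal_rounds_def nth_append All_less_Suc)

lemma legal_rounds_subset:
  "legal_rounds b X rs \<Longrightarrow> maker_set rs \<subseteq> X \<and> breaker_set rs \<subseteq> X \<and> maker_set rs \<inter> breaker_set rs = {}"
  by (induction rs rule: rev_induct) (auto simp: legal_rounds_snoc unclaimed_eq)

text \<open>The analogue of \<open>follows\<close> inside one stage: the completed stages are
  absorbed into \<open>f\<close>, so that a stage can be analysed on its own and plugged in with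
  \<open>f\<close> = \<open>\<sigma> ps\<close>.\<close>

definition plays_by :: "('a stage \<Rightarrow> 'a) \<Rightarrow> 'a stage \<Rightarrow> bool" where
  "plays_by f rs \<longleftrightarrow> (\<forall>j<length rs. fst (rs ! j) = f (take j rs))"

lemma plays_by_Nil [simp]: "plays_by f []"
  by (simp add: plays_by_def)

lemma plays_by_snoc: "plays_by f (rs @ [r]) \<longleftrightarrow> plays_by f rs \<and> fst r = f rs"
  by (auto simp: plays_by_def nth_append less_Suc_eq)

lemma legal_game_snoc:
  "legal_game b X (ps @ [p]) \<longleftrightarrow> legal_game b X ps \<and> complete_stage b (board_after X ps) p"
  by (induction ps arbitrary: X) auto

lemma board_after_snoc [simp]: "board_after X (ps @ [p]) = maker_set p"
  by (induction ps arbitrary: X) auto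

lemma winning_after_snoc:
  "winning_after F (ps @ [p]) = {A \<in> winning_after F ps. A \<subseteq> maker_set p}"
  by (induction ps arbitrary: F) auto

lemma follows_Nil [simp]: "follows \<sigma> []"
  by (simp add: follows_def)

lemma follows_snoc: "follows \<sigma> (ps @ [p]) \<longleftrightarrow> follows \<sigma> ps \<and> plays_by (\<sigma> ps) p"
  by (auto simp: follows_def plays_by_def nth_append less_Suc_eq)

lemma board_after_subset: "legal_game b X ps \<Longrightarrow> board_after X ps \<subseteq> X"
proof (induction ps rule: rev_induct)
  case (snoc p ps)
  then have "maker_set p \<subseteq> board_after X ps"
    using legal_rounds_subset[of b "board_after X ps" p]
    by (auto simp: legal_game_snoc complete_stage_def)
  with snoc show ?case by (auto simp: legal_game_snoc)
qed simp

text \<open>Boards only shrink, so surviving every stage amounts to lying in the last board. The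
  assumption on \<open>F\<close> settles the empty game.\<close>

lemma winning_after_eq:
  "legal_game b X ps \<Longrightarrow> (\<And>A. A \<in> F \<Longrightarrow> A \<subseteq> X) \<Longrightarrow>
     winning_after F ps = {A \<in> F. A \<subseteq> board_after X ps}"
proof (induction ps rule: rev_induct)
  case (snoc p ps)
  then have "maker_set p \<subseteq> board_after X ps"
    using legal_rounds_subset[of b "board_after X ps" p]
    by (auto simp: legal_game_snoc complete_stage_def)
  with snoc show ?case by (auto simp: legal_game_snoc winning_after_snoc)
qed auto

section \<open>Breaker's strategy\<close>

text \<open>Breaker completes the stage from any position, by induction on the number of unclaimed
  elements. A full round adds \<open>b + 1\<close> to the first summand of the invariant and takes
  \<open>b + 1\<close> from the second; only the last round can be short, and it costs at most
  \<open>b\<close>.\<close>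

lemma breaker_stage_from:
  assumes X: "finite X"
    and f: "\<And>rs. legal_rounds b X rs \<Longrightarrow> unclaimed X rs \<noteq> {} \<Longrightarrow> f rs \<in> unclaimed X rs"
    and "legal_rounds b X rs" "plays_by f rs"
    and "(b + 1) * card (maker_set rs) + card (unclaimed X rs) \<le> card X"
  shows "\<exists>p. complete_stage b X p \<and> plays_by f p \<and> (b + 1) * card (maker_set p) \<le> card X + b"
  using assms(3-)
proof (induction "card (unclaimed X rs)" arbitrary: rs rule: less_induct)
  case less
  let ?U = "unclaimed X rs"
  have finU: "finite ?U" using X by (simp add: unclaimed_eq)
  have finM: "finite (maker_set rs)" by (simp add: maker_set_def)
  show ?case
  proof (cases "?U = {}")
    case True
    with less.prems show ?thesis by (intro exI[of _ rs]) (auto simp: complete_stage_def)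
  next
    case False
    define m where "m = f rs"
    have m: "m \<in> ?U" unfolding m_def using f less.prems False by blast
    obtain B where B: "B \<subseteq> ?U - {m}" "card B = min b (card (?U - {m}))" "finite B"
      using obtain_subset_with_card_n[of "min b (card (?U - {m}))" "?U - {m}"] by auto
    let ?rs = "rs @ [(m, B)]"
    have legal: "legal_rounds b X ?rs" using less.prems m B by (simp add: legal_rounds_snoc)
    have plays: "plays_by f ?rs" using less.prems by (simp add: plays_by_snoc m_def)
    have cardM: "card (maker_set ?rs) = Suc (card (maker_set rs))"
      using m finM by (simp add: unclaimed_eq)
    have U': "unclaimed X ?rs = ?U - {m} - B" by (auto simp: unclaimed_eq)
    have cU: "card (?U - {m}) = card ?U - 1" "card ?U \<ge> 1"
      using m finU by (auto simp: Suc_le_eq card_gt_0_iff)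
    have cU': "card (unclaimed X ?rs) = card ?U - 1 - card B"
      unfolding U' using B cU by (subst card_Diff_subset) auto
    show ?thesis
    proof (cases "b \<le> card (?U - {m})")
      case True
      show ?thesis
      proof (rule less.hyps[OF _ legal plays])
        show "card (unclaimed X ?rs) < card ?U" using cU cU' by linarith
        show "(b + 1) * card (maker_set ?rs) + card (unclaimed X ?rs) \<le> card X"
          using less.prems(3) True B(2) cU cU' by (simp add: cardM del: maker_set_snoc)
      qed
    next
      case False
      then have "unclaimed X ?rs = {}"
        using cU cU' B finU by (subst card_0_eq[symmetric]) (auto simp: U')
      \<comment> \<open>Before this short round at least \<open>m\<close> was unclaimed, so of the
        \<open>b + 1\<close> charged for it at least one is paid for by the invariant.\<close>
      moreover have "(b + 1) * card (maker_set ?rs) \<le> card X + b"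
        using less.prems(3) cU by (simp add: cardM del: maker_set_snoc)
      ultimately show ?thesis using legal plays by (auto simp: complete_stage_def)
    qed
  qed
qed

lemma breaker_stage:
  assumes "finite X"
    and "\<And>rs. legal_rounds b X rs \<Longrightarrow> unclaimed X rs \<noteq> {} \<Longrightarrow> f rs \<in> unclaimed X rs"
  shows "\<exists>p. complete_stage b X p \<and> plays_by f p \<and> (b + 1) * card (maker_set p) \<le> card X + b"
  by (rule breaker_stage_from[OF assms, where rs = "[]"]) (simp_all add: unclaimed_eq)

text \<open>Subtracting 1 absorbs the rounding: m' (b + 1) \<le> m + b is the same as (m' - 1) (b +
  1) \<le> m - 1, which iterates to a pure power.\<close>

lemma breaker_game:
  assumes X: "finite X" and \<sigma>: "maker_strategy b X \<sigma>"
  shows "\<exists>ps. length ps = s \<and> legal_game b X ps \<and> follows \<sigma> ps \<and>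
    (real (card (board_after X ps)) - 1) * (real b + 1) ^ s \<le> real (card X) - 1"
proof (induction s)
  case 0
  show ?case by (intro exI[of _ "[]"]) auto
next
  case (Suc s)
  then obtain ps where ps: "length ps = s" "legal_game b X ps" "follows \<sigma> ps"
    "(real (card (board_after X ps)) - 1) * (real b + 1) ^ s \<le> real (card X) - 1" by blast
  let ?Y = "board_after X ps"
  have "finite ?Y" using board_after_subset[OF ps(2)] X finite_subset by blast
  then obtain p where p: "complete_stage b ?Y p" "plays_by (\<sigma> ps) p"
    "(b + 1) * card (maker_set p) \<le> card ?Y + b"
    using breaker_stage[of ?Y b "\<sigma> ps"] \<sigma> ps(2) unfolding maker_strategy_def by blast
  have "(real b + 1) * real (card (maker_set p)) \<le> real (card ?Y) + real b"
    using of_nat_mono[OF p(3), where 'a = real] by (simp add: algebra_simps)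
  then have "(real (card (maker_set p)) - 1) * (real b + 1) \<le> real (card ?Y) - 1"
    by (simp add: algebra_simps)
  then have "(real (card (maker_set p)) - 1) * (real b + 1) * (real b + 1) ^ s
      \<le> (real (card ?Y) - 1) * (real b + 1) ^ s"
    by (intro mult_right_mono) auto
  with ps(4) have "(real (card (maker_set p)) - 1) * (real b + 1) ^ Suc s \<le> real (card X) - 1"
    unfolding power_Suc mult.assoc by linarith
  with ps p show ?case
    by (intro exI[of _ "ps @ [p]"]) (auto simp: legal_game_snoc follows_snoc)
qed

section \<open>Maker's strategy\<close>

text \<open>Stated for an arbitrary weighted family \<open>A\<close> of sets, of each of which Maker
  wants a large share; the cuts come in later. The division by \<open>b\<close> makes a full round
  of Breaker inside \<open>A i\<close> cost a factor 1 + \<open>\<nu>\<close>, against 1 -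
  \<open>\<nu>\<close> for one element of Maker.\<close>

definition potential ::
    "real \<Rightarrow> nat \<Rightarrow> ('i \<Rightarrow> real) \<Rightarrow> ('i \<Rightarrow> 'a set) \<Rightarrow> 'a stage \<Rightarrow> 'i \<Rightarrow> real" where
  "potential \<nu> b c A rs i = c i * (1 - \<nu>) ^ card (A i \<inter> maker_set rs) *
     (1 + \<nu>) powr (real (card (A i \<inter> breaker_set rs)) / real b)"

text \<open>Up to the factor \<open>\<nu>\<close>, this is the drop of the total potential if Maker
  claims the unclaimed element \<open>x\<close>.\<close>

definition danger ::
    "real \<Rightarrow> nat \<Rightarrow> 'i set \<Rightarrow> ('i \<Rightarrow> real) \<Rightarrow> ('i \<Rightarrow> 'a set) \<Rightarrow> 'a stage \<Rightarrow> 'a \<Rightarrow> real" where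
  "danger \<nu> b I c A rs x = (\<Sum>i\<in>I. potential \<nu> b c A rs i * of_bool (x \<in> A i))"

definition heaviest :: "('a \<Rightarrow> real) \<Rightarrow> 'a set \<Rightarrow> 'a" where
  "heaviest w U = (SOME x. x \<in> U \<and> (\<forall>y\<in>U. w y \<le> w x))"

lemma heaviest:
  assumes "finite U" "U \<noteq> {}"
  shows "heaviest w U \<in> U" and "y \<in> U \<Longrightarrow> w y \<le> w (heaviest w U)"
proof -
  have "Max (w ` U) \<in> w ` U" using assms by simp
  then obtain x where "x \<in> U" "w x = Max (w ` U)" by auto
  then have "\<exists>x. x \<in> U \<and> (\<forall>y\<in>U. w y \<le> w x)" using assms by (metis Max_ge finite_imageI imageI)
  from someI_ex[OF this] show "heaviest w U \<in> U" "y \<in> U \<Longrightarrow> w y \<le> w (heaviest w U)"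
    unfolding heaviest_def by auto
qed

text \<open>Weighted AM-GM for 1 + \<open>\<nu>\<close> and 1 with weights \<open>t\<close> and 1 -
  \<open>t\<close>.\<close>

lemma powr_le_linear:
  fixes \<nu> t :: real
  assumes "0 \<le> \<nu>" "0 \<le> t" "t \<le> 1"
  shows "(1 + \<nu>) powr t \<le> 1 + t * \<nu>"
  using Youngs_inequality_0[of t "1 - t" "1 + \<nu>" 1] assms by (simp add: algebra_simps)

lemma potential_nonneg:
  "0 \<le> c i \<Longrightarrow> 0 \<le> \<nu> \<Longrightarrow> \<nu> \<le> 1 \<Longrightarrow> 0 \<le> potential \<nu> b c A rs i"
  by (simp add: potential_def)

text \<open>The change is bounded by a factor that is linear in both moves, so that the effects of
  \<open>m\<close> and of \<open>B\<close> can be summed over \<open>i\<close> separately. The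
  linearisation needs \<open>?t\<close> \<le> 1, which holds since \<open>B\<close> has at most
  \<open>b\<close> elements; the cross term has the favourable sign.\<close>

lemma potential_snoc:
  assumes X: "finite X" and rs: "legal_rounds b X (rs @ [(m, B)])"
    and \<nu>: "0 \<le> \<nu>" "\<nu> \<le> 1" and c: "0 \<le> c i" and b: "b \<ge> 1"
  shows "potential \<nu> b c A (rs @ [(m, B)]) i \<le> potential \<nu> b c A rs i *
    (1 - \<nu> * of_bool (m \<in> A i) + \<nu> * (real (card (A i \<inter> B)) / real b))"
proof -
  let ?t = "real (card (A i \<inter> B)) / real b"
  have B: "finite B" "card B \<le> b" "B \<inter> breaker_set rs = {}" "m \<notin> maker_set rs"
    and leg: "legal_rounds b X rs"
    using rs by (auto simp: legal_rounds_snoc unclaimed_eq)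
  have fin: "finite (breaker_set rs)" "finite (maker_set rs)"
    using legal_rounds_subset[OF leg] X finite_subset by blast+
  have "A i \<inter> (B \<union> breaker_set rs) = (A i \<inter> B) \<union> (A i \<inter> breaker_set rs)" by auto
  then have cB: "card (A i \<inter> (B \<union> breaker_set rs)) = card (A i \<inter> B) + card (A i \<inter> breaker_set rs)"
    using B fin by (simp, subst card_Un_disjoint) auto
  have M: "(1 - \<nu>) ^ card (A i \<inter> insert m (maker_set rs)) =
      (1 - \<nu>) ^ card (A i \<inter> maker_set rs) * (1 - \<nu> * of_bool (m \<in> A i))"
    using B fin by (auto simp: Int_insert_right)
  have "card (A i \<inter> B) \<le> b"
    using B card_mono[of B "A i \<inter> B"] by auto
  then have t: "0 \<le> ?t" "?t \<le> 1" using b by auto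
  have "potential \<nu> b c A (rs @ [(m, B)]) i =
     potential \<nu> b c A rs i * ((1 - \<nu> * of_bool (m \<in> A i)) * (1 + \<nu>) powr ?t)"
    using \<nu> by (simp add: potential_def cB M add_divide_distrib powr_add mult_ac)
  also have "\<dots> \<le> potential \<nu> b c A rs i * ((1 - \<nu> * of_bool (m \<in> A i)) * (1 + ?t * \<nu>))"
    using \<nu> c t by (intro mult_left_mono powr_le_linear potential_nonneg) auto
  also have "\<dots> \<le> potential \<nu> b c A rs i * (1 - \<nu> * of_bool (m \<in> A i) + \<nu> * ?t)"
  proof (rule mult_left_mono)
    have "0 \<le> \<nu> * of_bool (m \<in> A i) * (?t * \<nu>)" using \<nu> t by simp
    then show "(1 - \<nu> * of_bool (m \<in> A i)) * (1 + ?t * \<nu>) \<le> 1 - \<nu> * of_bool (m \<in> A i) + \<nu> * ?t"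
      by (simp only: algebra_simps)
  qed (use \<nu> c potential_nonneg[of c i] in auto)
  finally show ?thesis .
qed

text \<open>The loss from Maker's element pays for each of Breaker's at most \<open>b\<close> elements at rate \<open>1/b\<close>.\<close>

lemma sum_potential_snoc:
  assumes X: "finite X" and rs: "legal_rounds b X (rs @ [(m, B)])" and I: "finite I"
    and \<nu>: "0 \<le> \<nu>" "\<nu> \<le> 1" and c: "\<And>i. i \<in> I \<Longrightarrow> 0 \<le> c i" and b: "b \<ge> 1"
    and m: "\<And>y. y \<in> unclaimed X rs \<Longrightarrow> danger \<nu> b I c A rs y \<le> danger \<nu> b I c A rs m"
  shows "(\<Sum>i\<in>I. potential \<nu> b c A (rs @ [(m, B)]) i) \<le> (\<Sum>i\<in>I. potential \<nu> b c A rs i)"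
proof -
  let ?w = "danger \<nu> b I c A rs"
  let ?p = "potential \<nu> b c A rs"
  have B: "finite B" "card B \<le> b" "B \<subseteq> unclaimed X rs"
    using rs by (auto simp: legal_rounds_snoc)
  have "0 \<le> ?w m" using \<nu> c by (auto simp: danger_def intro!: sum_nonneg potential_nonneg)
  \<comment> \<open>Breaker's elements were still unclaimed when Maker chose \<open>m\<close>, so
    none of them is more dangerous than \<open>m\<close>.\<close>
  have "(\<Sum>y\<in>B. ?w y) \<le> (\<Sum>y\<in>B. ?w m)" using B m by (intro sum_mono) auto
  also have "\<dots> \<le> real b * ?w m" using B \<open>0 \<le> ?w m\<close> by (simp add: mult_right_mono)
  finally have le: "(\<Sum>y\<in>B. ?w y) \<le> real b * ?w m" .
  have "(\<Sum>y\<in>B. ?w y) = (\<Sum>i\<in>I. ?p i * (\<Sum>y\<in>B. of_bool (y \<in> A i)))"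
    unfolding danger_def sum_distrib_left by (rule sum.swap)
  also have "\<dots> = (\<Sum>i\<in>I. ?p i * real (card (A i \<inter> B)))"
  proof (rule sum.cong[OF refl])
    fix i
    have "A i \<inter> B = {y \<in> B. y \<in> A i}" by auto
    then show "?p i * (\<Sum>y\<in>B. of_bool (y \<in> A i)) = ?p i * real (card (A i \<inter> B))"
      using B by (simp add: of_bool_def sum.If_cases Int_def conj_commute)
  qed
  finally have wB: "(\<Sum>y\<in>B. ?w y) = (\<Sum>i\<in>I. ?p i * real (card (A i \<inter> B)))" .
  have "(\<Sum>i\<in>I. potential \<nu> b c A (rs @ [(m, B)]) i) \<le>
      (\<Sum>i\<in>I. ?p i * (1 - \<nu> * of_bool (m \<in> A i) + \<nu> * (real (card (A i \<inter> B)) / real b)))"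
    by (rule sum_mono, rule potential_snoc[OF X rs \<nu> _ b]) (rule c)
  also have "\<dots> = (\<Sum>i\<in>I. ?p i) - \<nu> * ?w m + \<nu> / real b * (\<Sum>y\<in>B. ?w y)"
  proof -
    have "?p i * (1 - \<nu> * of_bool (m \<in> A i) + \<nu> * (real (card (A i \<inter> B)) / real b)) =
        ?p i - \<nu> * (?p i * of_bool (m \<in> A i)) + \<nu> / real b * (?p i * real (card (A i \<inter> B)))" for i
      by (simp add: algebra_simps)
    then show ?thesis
      unfolding wB unfolding danger_def sum_distrib_left by (simp only: sum.distrib sum_subtractf)
  qed
  also have "\<dots> \<le> (\<Sum>i\<in>I. ?p i) - \<nu> * ?w m + \<nu> / real b * (real b * ?w m)"
    using le \<nu> by (intro add_left_mono mult_left_mono) auto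
  also have "\<dots> = (\<Sum>i\<in>I. ?p i)" using b by simp
  finally show ?thesis .
qed

lemma sum_potential_le:
  assumes X: "finite X" and I: "finite I" and \<nu>: "0 \<le> \<nu>" "\<nu> \<le> 1"
    and c: "\<And>i. i \<in> I \<Longrightarrow> 0 \<le> c i" and b: "b \<ge> 1"
    and "legal_rounds b X rs" "plays_by (\<lambda>rs. heaviest (danger \<nu> b I c A rs) (unclaimed X rs)) rs"
  shows "(\<Sum>i\<in>I. potential \<nu> b c A rs i) \<le> (\<Sum>i\<in>I. c i)"
  using assms(7,8)
proof (induction rs rule: rev_induct)
  case Nil
  then show ?case using \<nu> by (simp add: potential_def)
next
  case (snoc r rs)
  obtain m B where r: "r = (m, B)" by (cases r)
  have leg: "legal_rounds b X (rs @ [(m, B)])" using snoc.prems r by simp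
  have m: "m = heaviest (danger \<nu> b I c A rs) (unclaimed X rs)"
    using snoc.prems r by (simp add: plays_by_snoc)
  have "finite (unclaimed X rs)" using X by (simp add: unclaimed_eq)
  then have max: "danger \<nu> b I c A rs y \<le> danger \<nu> b I c A rs m" if "y \<in> unclaimed X rs" for y
    using heaviest(2)[of "unclaimed X rs" y "danger \<nu> b I c A rs"] that by (auto simp only: m)
  have "legal_rounds b X rs" "plays_by (\<lambda>rs. heaviest (danger \<nu> b I c A rs) (unclaimed X rs)) rs"
    using snoc.prems leg by (auto simp only: legal_rounds_snoc plays_by_snoc)
  from snoc.IH[OF this] have "(\<Sum>i\<in>I. potential \<nu> b c A rs i) \<le> (\<Sum>i\<in>I. c i)" .
  moreover have "(\<Sum>i\<in>I. potential \<nu> b c A (rs @ [r]) i) \<le> (\<Sum>i\<in>I. potential \<nu> b c A rs i)"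
    unfolding r by (rule sum_potential_snoc[OF X leg I \<nu> _ b]) (fact c, fact max)
  ultimately show ?case by linarith
qed

text \<open>With ln (1 - \<open>\<nu>\<close>) and ln (1 + \<open>\<nu>\<close>) replaced by
  -\<open>\<nu>\<close> and \<open>\<nu>\<close> up to second order, \<open>le\<close> says that
  Breaker's share divided by \<open>b\<close> hardly exceeds Maker's share plus \<open>L\<close> /
  \<open>\<nu>\<close>. By the lower bound on \<open>a\<close>, \<open>b\<close> times this last
  error is at most \<open>\<nu>\<close> \<open>a\<close>.\<close>

lemma maker_share_arith:
  fixes \<nu> a M L :: real
  assumes \<nu>: "0 < \<nu>" "\<nu> \<le> 1/4" and M: "0 \<le> M" "M \<le> a" and b: "b \<ge> (1::nat)"
    and le: "M * ln (1 - \<nu>) + (a - M) / b * ln (1 + \<nu>) \<le> L"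
    and a: "b * L / \<nu>\<^sup>2 \<le> a"
  shows "(1 - 4 * \<nu>) / (b + 1) * a \<le> M"
proof -
  have "- \<nu> - 2 * \<nu>\<^sup>2 \<le> ln (1 - \<nu>)" using ln_one_minus_pos_lower_bound[of \<nu>] \<nu> by simp
  then have 1: "M * (- \<nu> - 2 * \<nu>\<^sup>2) \<le> M * ln (1 - \<nu>)" using M by (intro mult_left_mono) auto
  have "\<nu> - \<nu>\<^sup>2 \<le> ln (1 + \<nu>)" using ln_one_plus_pos_lower_bound[of \<nu>] \<nu> by simp
  then have 2: "(a - M) / b * (\<nu> - \<nu>\<^sup>2) \<le> (a - M) / b * ln (1 + \<nu>)"
    using M b by (intro mult_left_mono) auto
  have "(a - M) / b * (\<nu> - \<nu>\<^sup>2) \<le> L + M * (\<nu> + 2 * \<nu>\<^sup>2)"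
    using 1 2 le by (simp add: algebra_simps)
  then have "(a - M) * (\<nu> - \<nu>\<^sup>2) \<le> b * L + b * (M * (\<nu> + 2 * \<nu>\<^sup>2))"
    using b by (simp add: field_simps)
  moreover have "b * L \<le> a * \<nu>\<^sup>2" using a \<nu> by (simp add: field_simps)
  ultimately have "\<nu> * ((a - M) * (1 - \<nu>)) \<le> \<nu> * (a * \<nu> + b * (M * (1 + 2 * \<nu>)))"
    by (simp add: algebra_simps power2_eq_square)
  then have "(a - M) * (1 - \<nu>) \<le> a * \<nu> + b * (M * (1 + 2 * \<nu>))" using \<nu> by simp
  moreover have "0 \<le> M * \<nu>" using M \<nu> by simp
  ultimately have "a * (1 - 2 * \<nu>) \<le> (b + 1) * M * (1 + 2 * \<nu>)" by (simp add: algebra_simps)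
  \<comment> \<open>The constant 4 comes from here: (1 - 4 \<open>\<nu>\<close>) (1 + 2
    \<open>\<nu>\<close>) = 1 - 2 \<open>\<nu>\<close> - 8 \<open>\<nu>\<close>^2.\<close>
  moreover have "a * ((1 - 4 * \<nu>) * (1 + 2 * \<nu>)) \<le> a * (1 - 2 * \<nu>)"
    using M \<nu> by (intro mult_left_mono) (auto simp: algebra_simps)
  ultimately have "(a * (1 - 4 * \<nu>)) * (1 + 2 * \<nu>) \<le> ((b + 1) * M) * (1 + 2 * \<nu>)"
    by (simp add: mult.assoc)
  then have "a * (1 - 4 * \<nu>) \<le> (b + 1) * M" using \<nu> by (subst (asm) mult_le_cancel_right) auto
  then show ?thesis by (simp add: field_simps)
qed

text \<open>A single potential is at most the total, which never exceeds its initial value;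
  logarithms then give the hypothesis of \<open>maker_share_arith\<close>. \<open>L\<close> measures
  how light the index \<open>i\<close> is compared with the whole family: lighter sets must be
  larger to be protected.\<close>

lemma maker_stage:
  assumes X: "finite X" and I: "finite I" and \<nu>: "0 < \<nu>" "\<nu> \<le> 1/4"
    and c: "\<And>i. i \<in> I \<Longrightarrow> 0 < c i" and b: "b \<ge> 1"
    and p: "complete_stage b X p"
      "plays_by (\<lambda>rs. heaviest (danger \<nu> b I c A rs) (unclaimed X rs)) p"
    and i: "i \<in> I" and L: "(\<Sum>i\<in>I. c i) \<le> c i * exp L"
    and a: "real b * L / \<nu>\<^sup>2 \<le> real (card (A i \<inter> X))"
  shows "(1 - 4 * \<nu>) / (real b + 1) * real (card (A i \<inter> X)) \<le> real (card (A i \<inter> maker_set p))"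
proof -
  let ?M = "card (A i \<inter> maker_set p)" and ?B = "card (A i \<inter> breaker_set p)"
  have leg: "legal_rounds b X p" and un: "unclaimed X p = {}"
    using p by (auto simp: complete_stage_def)
  have "A i \<inter> X = (A i \<inter> maker_set p) \<union> (A i \<inter> breaker_set p)"
    using legal_rounds_subset[OF leg] un by (auto simp: unclaimed_eq)
  moreover have "finite (breaker_set p)" "finite (maker_set p)"
    using legal_rounds_subset[OF leg] X finite_subset by blast+
  ultimately have card: "card (A i \<inter> X) = ?M + ?B"
    using legal_rounds_subset[OF leg] by (simp, subst card_Un_disjoint) auto
  have "potential \<nu> b c A p i \<le> (\<Sum>i\<in>I. potential \<nu> b c A p i)"
    using I i c \<nu> by (intro member_le_sum potential_nonneg) (auto simp: less_imp_le)
  also have "\<dots> \<le> (\<Sum>i\<in>I. c i)"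
    using c \<nu> by (intro sum_potential_le[OF X I _ _ _ b leg p(2)]) (auto simp: less_imp_le)
  also note L
  finally have "(1 - \<nu>) ^ ?M * (1 + \<nu>) powr (real ?B / real b) \<le> exp L"
    using c[OF i] by (simp add: potential_def mult.assoc)
  then have "ln ((1 - \<nu>) ^ ?M * (1 + \<nu>) powr (real ?B / real b)) \<le> ln (exp L)"
    using \<nu> by (subst ln_le_cancel_iff) auto
  then have "real ?M * ln (1 - \<nu>) + real ?B / real b * ln (1 + \<nu>) \<le> L"
    using \<nu> by (simp add: ln_mult ln_realpow ln_powr)
  then show ?thesis using a \<nu> b card by (intro maker_share_arith[where L = L]) auto
qed

section \<open>Cuts and spanning trees\<close>

definition cut :: "'v set \<Rightarrow> 'v set \<Rightarrow> 'v set set" where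
  "cut V S = (\<lambda>(u, v). {u, v}) ` (S \<times> (V - S))"

lemma card_cut:
  assumes "finite V" "S \<subseteq> V"
  shows "card (cut V S) = card S * (card V - card S)"
proof -
  have "inj_on (\<lambda>(u, v). {u, v}) (S \<times> (V - S))"
    by (auto simp: inj_on_def doubleton_eq_iff)
  moreover have "finite S" using assms finite_subset by blast
  ultimately show ?thesis
    using assms by (simp add: cut_def card_image card_cartesian_product card_Diff_subset)
qed

lemma cut_compl: "S \<subseteq> V \<Longrightarrow> cut V (V - S) = cut V S"
  by (auto simp: cut_def double_diff insert_commute image_iff)

text \<open>No edge leaves the set of vertices reachable from \<open>u\<close>. A set and its
  complement have the same cut, so it is enough to know the cuts of sets with at most half of the
  vertices; these are the cuts with many edges per vertex of \<open>S\<close>.\<close>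

lemma connected_on_if_cuts:
  assumes V: "finite V" "V \<noteq> {}"
    and E: "\<And>S. S \<subseteq> V \<Longrightarrow> S \<noteq> {} \<Longrightarrow> 2 * card S \<le> card V \<Longrightarrow> cut V S \<inter> E \<noteq> {}"
  shows "connected_on V E"
  unfolding connected_on_def
proof (intro conjI ballI)
  fix u v assume uv: "u \<in> V" "v \<in> V"
  let ?R = "{(x, y). {x, y} \<in> E}\<^sup>*"
  define C where "C = {w \<in> V. (u, w) \<in> ?R}"
  have C: "C \<subseteq> V" "u \<in> C" using uv by (auto simp: C_def)
  show "(u, v) \<in> ?R"
  proof (rule ccontr)
    assume "(u, v) \<notin> ?R"
    then have "V - C \<noteq> {}" using uv by (auto simp: C_def)
    have "card (V - C) = card V - card C" "card C \<le> card V"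
      using C V by (auto simp: card_Diff_subset finite_subset card_mono)
    then have "2 * card C \<le> card V \<or> 2 * card (V - C) \<le> card V" by linarith
    then have "cut V C \<inter> E \<noteq> {}"
      using E[of C] E[of "V - C"] C \<open>V - C \<noteq> {}\<close> by (auto simp: cut_compl)
    then obtain x y where "x \<in> C" "y \<in> V - C" "{x, y} \<in> E" by (auto simp: cut_def)
    then show False by (auto simp: C_def intro: rtrancl_into_rtrancl)
  qed
qed (use V in auto)

text \<open>The edge closing the cycle is deleted; the rest of the cycle is a path between its ends,
  along which every walk can be rerouted.\<close>

lemma connected_on_delete_cycle_edge:
  assumes T: "connected_on V T" and cyc: "is_cycle T vs"
  shows "\<exists>e\<in>T. connected_on V (T - {e})"
proof -
  let ?l = "length vs - 1"
  let ?e = "{vs ! ?l, vs ! 0}"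
  let ?R' = "{(x, y). {x, y} \<in> T - {?e}}"
  have l: "length vs \<ge> 3" and dist: "distinct vs"
    and edges: "\<And>i. i < length vs \<Longrightarrow> {vs ! i, vs ! (Suc i mod length vs)} \<in> T"
    using cyc by (auto simp: is_cycle_def)
  have "?e \<in> T"
  proof -
    have "Suc ?l mod length vs = 0" "?l < length vs" using l by (cases "length vs"; simp)+
    then show ?thesis using edges[of ?l] by metis
  qed
  have path: "(vs ! 0, vs ! i) \<in> ?R'\<^sup>*" if "i \<le> ?l" for i
    using that
  proof (induction i)
    case (Suc i)
    have "{vs ! i, vs ! Suc i} \<in> T" using edges[of i] Suc.prems by simp
    have "0 < length vs" "i < length vs" "Suc i < length vs" "?l < length vs" using l Suc.prems by auto
    then have "vs ! Suc i \<noteq> vs ! 0" "vs ! Suc i = vs ! ?l \<Longrightarrow> Suc i = ?l" "vs ! i = vs ! 0 \<Longrightarrow> i = 0"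
      using dist nth_eq_iff_index_eq[OF dist, of "Suc i" 0] nth_eq_iff_index_eq[OF dist, of "Suc i" ?l]
        nth_eq_iff_index_eq[OF dist, of i 0] by blast+
    \<comment> \<open>Here length at least 3 matters: on two vertices the path edge would be the
      closing edge read backwards.\<close>
    moreover have "\<not> (i = 0 \<and> Suc i = ?l)" using l by linarith
    ultimately have "{vs ! i, vs ! Suc i} \<noteq> ?e" by (metis doubleton_eq_iff)
    with \<open>{vs ! i, vs ! Suc i} \<in> T\<close> show ?case using Suc by (auto intro: rtrancl_into_rtrancl)
  qed simp
  have "sym ?R'" by (auto simp: sym_def insert_commute)
  then have "sym (?R'\<^sup>*)" by (rule sym_rtrancl)
  then have "(vs ! ?l, vs ! 0) \<in> ?R'\<^sup>*" using path[of ?l] by (auto dest: symD)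
  then have "{(x, y). {x, y} \<in> T} \<subseteq> ?R'\<^sup>*"
    using path[of ?l] by (auto simp: doubleton_eq_iff)
  then have "{(x, y). {x, y} \<in> T}\<^sup>* \<subseteq> ?R'\<^sup>*" by (rule rtrancl_subset_rtrancl)
  then show ?thesis using T \<open>?e \<in> T\<close> unfolding connected_on_def by blast
qed

text \<open>A connected edge set of least cardinality has no cycle, since a cycle edge could be
  deleted.\<close>

lemma spanning_tree_exists:
  assumes "finite E" "connected_on V E"
  shows "\<exists>T. spanning_tree V E T"
proof -
  define T where "T = arg_min card (\<lambda>T. T \<subseteq> E \<and> connected_on V T)"
  have T: "T \<subseteq> E" "connected_on V T"
    using arg_min_natI[of "\<lambda>T. T \<subseteq> E \<and> connected_on V T" E card] assms by (auto simp: T_def)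
  have min: "card T \<le> card T'" if "T' \<subseteq> E" "connected_on V T'" for T'
    using arg_min_nat_le[of "\<lambda>T. T \<subseteq> E \<and> connected_on V T" T' card] that by (auto simp: T_def)
  have "\<not> is_cycle T vs" for vs
  proof
    assume "is_cycle T vs"
    then obtain e where "e \<in> T" "connected_on V (T - {e})"
      using connected_on_delete_cycle_edge T by blast
    then have "card T \<le> card (T - {e})" using T(1) by (intro min) auto
    moreover have "card (T - {e}) < card T"
      using \<open>e \<in> T\<close> T(1) assms(1) by (intro card_Diff1_less) (auto intro: finite_subset)
    ultimately show False by simp
  qed
  with T show ?thesis by (auto simp: spanning_tree_def)
qed

text \<open>Every vertex lies on an edge, and an edge covers two vertices. The factor lost against
  the sharp bound vanishes in the asymptotics.\<close>

lemma connected_on_card_le: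
  assumes T: "connected_on V T" "finite T" "\<And>e. e \<in> T \<Longrightarrow> card e = 2" and V: "card V \<ge> 2"
  shows "card V \<le> 2 * card T"
proof -
  have "V \<subseteq> \<Union>T"
  proof
    fix u assume u: "u \<in> V"
    have "V \<noteq> {u}" using V by auto
    then obtain v where "v \<in> V" "v \<noteq> u" using u by blast
    then have "(u, v) \<in> {(x, y). {x, y} \<in> T}\<^sup>*" using T u by (auto simp: connected_on_def)
    then show "u \<in> \<Union>T" using \<open>v \<noteq> u\<close> by (cases rule: converse_rtranclE) auto
  qed
  moreover have "finite (\<Union>T)" using T by (intro finite_Union) (auto intro: card_ge_0_finite)
  ultimately have "card V \<le> card (\<Union>T)" by (intro card_mono)
  also have "\<dots> \<le> (\<Sum>e\<in>T. card e)" by (rule card_Union_le_sum_card)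
  also have "\<dots> = 2 * card T" using T by simp
  finally show ?thesis .
qed

section \<open>Bounds on the threshold\<close>

lemma finite_complete_edges: "finite (complete_edges n)"
  by (rule finite_subset[of _ "Pow {..<n}"]) (auto simp: complete_edges_def)

lemma card_complete_edges: "card (complete_edges n) = n choose 2"
  unfolding complete_edges_def using n_subsets[of "{..<n}" 2] by simp

lemma cut_subset_complete_edges: "S \<subseteq> {..<n} \<Longrightarrow> cut {..<n} S \<subseteq> complete_edges n"
  by (auto simp: cut_def complete_edges_def card_2_iff)

section \<open>Upper bound: the last board must still contain a spanning tree\<close>

lemma maker_survives_imp_le:
  assumes n: "n \<ge> 3" and surv: "maker_survives (connectivity_hypergraph n) b s"
  shows "(real b + 1) ^ s \<le> real n + 1"
proof -
  let ?X = "complete_edges n" and ?F = "snd (connectivity_hypergraph n)"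
  obtain \<sigma> where \<sigma>: "maker_strategy b ?X \<sigma>"
    "\<And>ps. length ps = s \<Longrightarrow> legal_game b ?X ps \<Longrightarrow> follows \<sigma> ps \<Longrightarrow> winning_after ?F ps \<noteq> {}"
    using surv by (auto simp: maker_survives_def connectivity_hypergraph_def)
  obtain ps where ps: "length ps = s" "legal_game b ?X ps" "follows \<sigma> ps"
    "(real (card (board_after ?X ps)) - 1) * (real b + 1) ^ s \<le> real (card ?X) - 1"
    using breaker_game[OF finite_complete_edges \<sigma>(1)] by blast
  have sub: "A \<subseteq> ?X" if "A \<in> ?F" for A
    using that by (auto simp: connectivity_hypergraph_def spanning_tree_def)
  from \<sigma>(2)[OF ps(1-3)] obtain T where T: "T \<in> ?F" "T \<subseteq> board_after ?X ps"
    using winning_after_eq[OF ps(2) sub] by auto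
  have finB: "finite (board_after ?X ps)"
    using board_after_subset[OF ps(2)] finite_complete_edges finite_subset by blast
  have "card {..<n} \<le> 2 * card T"
  proof (rule connected_on_card_le)
    show "connected_on {..<n} T"
      using T by (simp add: connectivity_hypergraph_def spanning_tree_def)
    show "finite T" using T finB finite_subset by blast
    show "card e = 2" if "e \<in> T" for e using that sub[OF T(1)] by (auto simp: complete_edges_def)
  qed (use n in simp)
  also have "\<dots> \<le> 2 * card (board_after ?X ps)" using T finB card_mono by simp
  finally have "real n / 2 \<le> real (card (board_after ?X ps))" by simp
  then have "(real n / 2 - 1) * (real b + 1) ^ s \<le> real (card ?X) - 1"
    using ps(4) by (smt (verit) mult_right_mono zero_le_power of_nat_0_le_iff)
  also have "real (card ?X) = real n * (real n - 1) / 2"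
    unfolding card_complete_edges using n by (simp add: choose_two real_of_nat_div of_nat_diff)
  \<comment> \<open>The factor n - 2 cancels exactly, because n (n - 1) / 2 - 1 = (n - 2) (n + 1) /
    2.\<close>
  finally have "(real n - 2) * (real b + 1) ^ s \<le> (real n - 2) * (real n + 1)"
    by (simp add: field_simps)
  moreover have "real n - 2 > 0" using n by linarith
  ultimately show ?thesis by (simp only: mult_le_cancel_left_pos)
qed

section \<open>Lower bound: Maker keeps all cuts large\<close>

lemma sum_power_card_Pow:
  fixes x :: "'b::comm_semiring_1"
  assumes "finite V"
  shows "(\<Sum>S\<in>Pow V. x ^ card S) = (1 + x) ^ card V"
  using prod_add[OF assms, of "\<lambda>_. x" "\<lambda>_. 1"] by (simp add: add.commute)

text \<open>The weight n^(-k) offsets the number of vertex sets of size k, so that the total weight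
  stays bounded: the binomial theorem gives (1 + 1/n)^n \<le> e.\<close>

lemma sum_inverse_power_card_le:
  assumes n: "n \<ge> 1" and I: "I \<subseteq> Pow {..<n}"
  shows "(\<Sum>S\<in>I. (1 / real n) ^ card S) \<le> exp 1"
proof -
  have "(\<Sum>S\<in>I. (1 / real n) ^ card S) \<le> (\<Sum>S\<in>Pow {..<n}. (1 / real n) ^ card S)"
    using I by (intro sum_mono2) auto
  also have "\<dots> = (1 + 1 / real n) ^ n" by (simp add: sum_power_card_Pow)
  also have "\<dots> \<le> exp (1 / real n) ^ n" by (intro power_mono exp_ge_add_one_self) auto
  also have "\<dots> = exp 1" using n by (simp flip: exp_of_nat_mult)
  finally show ?thesis .
qed

text \<open>Each stage multiplies the guaranteed size of every cut by \<open>q\<close>, starting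
  from |S| n / 2. Assumption \<open>s\<close>, multiplied by |S|, says that this guarantee is still
  above the size required by \<open>maker_stage\<close> when it has shrunk by
  \<open>q ^ s\<close>.\<close>

lemma maker_survives_connectivity:
  assumes n: "n \<ge> 3" and b: "b \<ge> 1" and \<nu>: "0 < \<nu>" "\<nu> < 1/4"
    and s: "2 * real b * ln (real n) / \<nu>\<^sup>2 \<le> real n / 2 * ((1 - 4 * \<nu>) / (real b + 1)) ^ s"
  shows "maker_survives (connectivity_hypergraph n) b s"
proof -
  define X where "X = complete_edges n"
  define V where "V = {..<n}"
  define q where "q = (1 - 4 * \<nu>) / (real b + 1)"
  define c where "c S = (1 / real n) ^ card S" for S :: "nat set"
  define I where "I = {S \<in> Pow V. S \<noteq> {} \<and> 2 * card S \<le> n}"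
  define f where "f Y rs = heaviest (danger \<nu> b I c (cut V) rs) (unclaimed Y rs)" for Y rs
  define \<sigma> where "\<sigma> ps = f (board_after X ps)" for ps
  have X: "finite X" by (simp add: X_def finite_complete_edges)
  have finY: "finite (board_after X ps)" if "legal_game b X ps" for ps
    using board_after_subset[OF that] X finite_subset by blast
  have I: "finite I" "I \<subseteq> Pow V" by (auto simp: I_def V_def)
  have q: "0 < q" "q \<le> 1" using \<nu> b by (auto simp: q_def field_simps)
  have c: "0 < c S" for S using n by (simp add: c_def)
  have "exp 1 \<le> real n" using e_less_272 n by linarith
  then have ln1: "1 \<le> ln (real n)" using n by (subst ln_ge_iff) auto
  have strat: "maker_strategy b X \<sigma>"
    unfolding maker_strategy_def \<sigma>_def f_def
    by (intro allI impI heaviest(1)) (auto simp: unclaimed_eq intro: finY)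
  have cuts: "real (card S) * (real n / 2) * q ^ length ps \<le> real (card (cut V S \<inter> board_after X ps))"
    if "legal_game b X ps" "follows \<sigma> ps" "length ps \<le> s" "S \<in> I" for ps S
    using that
  proof (induction ps arbitrary: S rule: rev_induct)
    case Nil
    then have S: "S \<subseteq> V" "2 * card S \<le> n" by (auto simp: I_def)
    have "cut V S \<inter> X = cut V S"
      using cut_subset_complete_edges S by (auto simp: X_def V_def)
    moreover have "real (card S) * (real n / 2) \<le> real (card S) * real (n - card S)"
      using S by (intro mult_left_mono) auto
    ultimately show ?case using S by (simp add: card_cut V_def)
  next
    case (snoc p ps)
    \<comment> \<open>One copy of |S| ln n in \<open>?L\<close> cancels the weight
      \<open>c S\<close>; the other is at least 1 and pays for the total weight, which is at most
      \<open>exp 1\<close>.\<close>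
    let ?Y = "board_after X ps" and ?L = "2 * real (card S) * ln (real n)"
    have leg: "legal_game b X ps" "complete_stage b ?Y p" and fol: "follows \<sigma> ps" "plays_by (f ?Y) p"
      using snoc.prems unfolding legal_game_snoc follows_snoc by (simp_all add: \<sigma>_def)
    have IH: "real (card S) * (real n / 2) * q ^ length ps \<le> real (card (cut V S \<inter> ?Y))"
      using snoc leg fol by simp
    have "S \<noteq> {}" "finite S" using snoc.prems by (auto simp: I_def V_def finite_subset)
    then have k: "1 \<le> real (card S)" by (simp add: Suc_le_eq card_gt_0_iff)
    have "1 * 1 \<le> real (card S) * ln (real n)" using k ln1 by (intro mult_mono) auto
    then have "exp 1 \<le> exp (?L - real (card S) * ln (real n))" by simp
    also have "\<dots> = c S * exp ?L"
    proof -
      have "c S = exp (- (real (card S) * ln (real n)))"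
        using n by (simp add: c_def exp_minus exp_of_nat_mult power_inverse flip: inverse_eq_divide)
      then show ?thesis by (simp flip: exp_add)
    qed
    finally have L: "(\<Sum>S\<in>I. c S) \<le> c S * exp ?L"
      using sum_inverse_power_card_le[of n I] I n unfolding c_def V_def by linarith
    have "real b * ?L / \<nu>\<^sup>2 = real (card S) * (2 * real b * ln (real n) / \<nu>\<^sup>2)" by simp
    also have "\<dots> \<le> real (card S) * (real n / 2 * q ^ s)"
      using s by (intro mult_left_mono) (auto simp: q_def)
    also have "\<dots> \<le> real (card S) * (real n / 2 * q ^ length ps)"
      using q snoc.prems by (intro mult_left_mono power_decreasing) auto
    also have "\<dots> \<le> real (card (cut V S \<inter> ?Y))" using IH by (simp add: mult.assoc)
    finally have "q * real (card (cut V S \<inter> ?Y)) \<le> real (card (cut V S \<inter> maker_set p))"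
      unfolding q_def using \<nu> c snoc.prems fol(2)[unfolded f_def] L
      by (intro maker_stage[OF finY[OF leg(1)] I(1) _ _ _ b leg(2)]) auto
    moreover have "q * (real (card S) * (real n / 2) * q ^ length ps) \<le> q * real (card (cut V S \<inter> ?Y))"
      using IH q by (intro mult_left_mono) auto
    ultimately show ?case by (simp add: mult_ac)
  qed
  have "winning_after (snd (connectivity_hypergraph n)) ps \<noteq> {}"
    if ps: "length ps = s" "legal_game b X ps" "follows \<sigma> ps" for ps
  proof -
    have "connected_on V (board_after X ps)"
    proof (rule connected_on_if_cuts)
      fix S assume S: "S \<subseteq> V" "S \<noteq> {}" "2 * card S \<le> card V"
      then have "S \<in> I" by (auto simp: I_def V_def)
      have "0 < card S" using S finite_subset by (auto simp: card_gt_0_iff V_def)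
      then have "0 < real (card S) * (real n / 2) * q ^ length ps" using n q by simp
      also note cuts[OF ps(2,3) _ \<open>S \<in> I\<close>]
      finally show "cut V S \<inter> board_after X ps \<noteq> {}" using ps by (auto intro!: Nat.gr0I)
    qed (use n in \<open>auto simp: V_def lessThan_empty_iff\<close>)
    then obtain T where "spanning_tree V (board_after X ps) T"
      using spanning_tree_exists finY[OF ps(2)] by blast
    then have "T \<in> snd (connectivity_hypergraph n)" "T \<subseteq> board_after X ps"
      using board_after_subset[OF ps(2)]
      by (auto simp: connectivity_hypergraph_def spanning_tree_def V_def X_def)
    moreover have "A \<subseteq> X" if "A \<in> snd (connectivity_hypergraph n)" for A
      using that by (auto simp: connectivity_hypergraph_def spanning_tree_def X_def)
    ultimately show ?thesis using winning_after_eq[OF ps(2)] by blast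
  qed
  then show ?thesis using strat
    by (auto simp: maker_survives_def connectivity_hypergraph_def X_def)
qed

text \<open>\<open>GREATEST\<close> has a meaning only if the surviving numbers are nonempty and
  bounded; \<open>s\<close> gives the former, and t \<le> 2^t \<le> (b + 1)^t \<le> n + 1 the
  latter.\<close>

lemma
  assumes n: "n \<ge> 3" and b: "b \<ge> 1" and s: "maker_survives (connectivity_hypergraph n) b s"
  shows tau_ge: "s \<le> tau (connectivity_hypergraph n) b"
    and tau_le: "(real b + 1) ^ tau (connectivity_hypergraph n) b \<le> real n + 1"
proof -
  have bound: "t \<le> n + 1" if "maker_survives (connectivity_hypergraph n) b t" for t
  proof -
    have "real t \<le> 2 ^ t" by (rule of_nat_less_two_power[THEN less_imp_le])
    also have "(2::real) ^ t \<le> (real b + 1) ^ t" using b by (intro power_mono) auto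
    also have "\<dots> \<le> real n + 1" by (rule maker_survives_imp_le[OF n that])
    finally show ?thesis by linarith
  qed
  then show "s \<le> tau (connectivity_hypergraph n) b"
    unfolding tau_def using s by (intro Greatest_le_nat) auto
  have "maker_survives (connectivity_hypergraph n) b (tau (connectivity_hypergraph n) b)"
    unfolding tau_def using s bound by (rule GreatestI_nat)
  then show "(real b + 1) ^ tau (connectivity_hypergraph n) b \<le> real n + 1"
    by (rule maker_survives_imp_le[OF n])
qed

section \<open>Asymptotics of the threshold\<close>

text \<open>Since \<open>b n\<close> \<ge> 1, b + 1 is at most 2 b, so the little-o bound is used
  with constant 1/2.\<close>

lemma subpolynomial_eventually_le:
  fixes b :: "nat \<Rightarrow> nat"
  assumes b: "\<And>n. b n \<ge> 1" and sub: "subpolynomial (\<lambda>n. real (b n))" and \<delta>: "\<delta> > 0"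
  shows "eventually (\<lambda>n. real (b n) + 1 \<le> real n powr \<delta>) at_top"
proof -
  have "(\<lambda>n. real (b n)) \<in> o(\<lambda>n. real n powr \<delta>)" using sub \<delta> by (simp add: subpolynomial_def)
  from landau_o.smallD[OF this, of "1/2"]
  have "eventually (\<lambda>n. real (b n) \<le> 1/2 * real n powr \<delta>) at_top" by simp
  then show ?thesis
  proof eventually_elim
    case (elim n)
    then show ?case using b[of n] by linarith
  qed
qed

text \<open>As b + 1 \<ge> 2, the choice of \<open>\<nu>\<close> gives 1 - 4 \<open>\<nu>\<close>
  \<ge> (b + 1)^(-\<open>\<epsilon>\<close>/2), so a stage costs at most a factor (b + 1)^(1 +
  \<open>\<epsilon>\<close>/2). Since (1 - \<open>\<epsilon>\<close>) (1 +
  \<open>\<epsilon>\<close>/2) \<le> 1 - \<open>\<epsilon>\<close>/2, a power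
  n^(\<open>\<epsilon>\<close>/2) is left after \<open>s\<close> stages, which beats b ln n.\<close>

lemma maker_threshold_condition:
  fixes \<epsilon> \<nu> x :: real and n b s :: nat
  assumes \<epsilon>: "0 < \<epsilon>" "\<epsilon> < 1" and \<nu>: "1 - 4 * \<nu> = 2 powr (- \<epsilon> / 2)" "0 < \<nu>"
    and n: "n \<ge> 3" and b: "b \<ge> 1" and s: "real s \<le> (1 - \<epsilon>) * log (real b + 1) (real n)"
    and bn: "real b + 1 \<le> real n powr (\<epsilon> / 4)"
    and large: "2 * real n powr (\<epsilon> / 4) * ln (real n) / \<nu>\<^sup>2 \<le> real n powr (\<epsilon> / 2) / 2"
  shows "2 * real b * ln (real n) / \<nu>\<^sup>2 \<le> real n / 2 * ((1 - 4 * \<nu>) / (real b + 1)) ^ s"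
proof -
  let ?\<beta> = "ln (real b + 1)"
  have \<beta>: "ln 2 \<le> ?\<beta>" "0 < ?\<beta>" using b by auto
  have "0 < ln (real n)" using n by simp
  have s\<beta>: "real s * ?\<beta> \<le> (1 - \<epsilon>) * ln (real n)"
    using s \<beta> by (simp add: log_def field_simps)
  have "real s * (?\<beta> + \<epsilon> / 2 * ln 2) \<le> real s * (?\<beta> + \<epsilon> / 2 * ?\<beta>)"
    using \<beta> \<epsilon> by (intro mult_left_mono add_left_mono) auto
  also have "\<dots> = (real s * ?\<beta>) * (1 + \<epsilon> / 2)" by (simp add: algebra_simps)
  also have "\<dots> \<le> ((1 - \<epsilon>) * ln (real n)) * (1 + \<epsilon> / 2)"
    using s\<beta> \<epsilon> by (intro mult_right_mono) auto
  also have "\<dots> = ln (real n) * ((1 - \<epsilon>) * (1 + \<epsilon> / 2))" by (simp add: mult_ac)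
  also have "\<dots> \<le> ln (real n) * (1 - \<epsilon> / 2)"
    using \<open>0 < ln (real n)\<close> \<epsilon> by (intro mult_left_mono) (auto simp: algebra_simps)
  finally have exponent: "real s * (?\<beta> + \<epsilon> / 2 * ln 2) \<le> ln (real n) * (1 - \<epsilon> / 2)" .
  have "(1 - 4 * \<nu>) / (real b + 1) = exp (- \<epsilon> / 2 * ln 2 - ?\<beta>)"
    unfolding \<nu> by (subst exp_diff) (simp add: powr_def)
  also have "- \<epsilon> / 2 * ln 2 - ?\<beta> = - (?\<beta> + \<epsilon> / 2 * ln 2)" by simp
  finally have "((1 - 4 * \<nu>) / (real b + 1)) ^ s = exp (- (real s * (?\<beta> + \<epsilon> / 2 * ln 2)))"
    by (simp add: algebra_simps flip: exp_of_nat_mult)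
  also have "\<dots> \<ge> exp (- (ln (real n) * (1 - \<epsilon> / 2)))" using exponent by simp
  finally have pow: "real n powr (\<epsilon> / 2 - 1) \<le> ((1 - 4 * \<nu>) / (real b + 1)) ^ s"
    using n by (simp add: powr_def algebra_simps)
  have "2 * real b * ln (real n) / \<nu>\<^sup>2 \<le> 2 * real n powr (\<epsilon> / 4) * ln (real n) / \<nu>\<^sup>2"
    using bn \<open>0 < ln (real n)\<close> by (intro divide_right_mono mult_right_mono) auto
  also note large
  also have "real n powr (\<epsilon> / 2) / 2 = real n / 2 * real n powr (\<epsilon> / 2 - 1)"
    using n by (simp add: powr_diff)
  also have "\<dots> \<le> real n / 2 * ((1 - 4 * \<nu>) / (real b + 1)) ^ s"
    using pow by (intro mult_left_mono) auto
  finally show ?thesis .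
qed

lemma eventually_tau_bounds:
  fixes b :: "nat \<Rightarrow> nat"
  assumes b: "\<And>n. b n \<ge> 1" and sub: "subpolynomial (\<lambda>n. real (b n))" and \<epsilon>: "0 < \<epsilon>" "\<epsilon> < 1"
  shows "eventually (\<lambda>n. 1 - 2 * \<epsilon> \<le> real (tau (connectivity_hypergraph n) (b n)) / log (real (b n) + 1) (real n) \<and>
    real (tau (connectivity_hypergraph n) (b n)) / log (real (b n) + 1) (real n) \<le> ln (real n + 1) / ln (real n)) at_top"
proof -
  define \<nu> where "\<nu> = (1 - 2 powr (- \<epsilon> / 2)) / 4"
  have "2 powr (- \<epsilon> / 2) < 2 powr (0::real)" using \<epsilon> by (intro powr_less_mono) auto
  then have \<nu>: "0 < \<nu>" "\<nu> < 1/4" "1 - 4 * \<nu> = 2 powr (- \<epsilon> / 2)" by (auto simp: \<nu>_def field_simps)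
  have "eventually (\<lambda>n. 2 * real n powr (\<epsilon> / 4) * ln (real n) / \<nu>\<^sup>2 \<le> real n powr (\<epsilon> / 2) / 2) at_top"
    using \<epsilon> \<nu>(1) by real_asymp
  moreover have "eventually (\<lambda>n. real (b n) + 1 \<le> real n powr (\<epsilon> / 4)) at_top"
    "eventually (\<lambda>n. real (b n) + 1 \<le> real n powr \<epsilon>) at_top"
    using subpolynomial_eventually_le[OF b sub] \<epsilon> by auto
  ultimately show ?thesis using eventually_ge_at_top[of 3]
  proof eventually_elim
    case (elim n)
    let ?H = "connectivity_hypergraph n" and ?\<beta> = "ln (real (b n) + 1)"
    let ?x = "log (real (b n) + 1) (real n)"
    have \<beta>: "0 < ?\<beta>" using b[of n] by auto
    have lnn: "0 < ln (real n)" using elim by simp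
    have x: "0 < ?x" using \<beta> lnn by (simp add: log_def)
    have "?\<beta> \<le> ln (real n powr \<epsilon>)" using elim(3,4) by (subst ln_le_cancel_iff) auto
    \<comment> \<open>This pays for rounding \<open>s\<close> down to an integer: one
      \<open>\<epsilon>\<close> in the lower bound is for the choice of \<open>s\<close>, the other
      for the rounding.\<close>
    then have "1 \<le> \<epsilon> * ?x" using \<beta> elim(4) by (simp add: log_def ln_powr field_simps)
    define s where "s = nat \<lfloor>(1 - \<epsilon>) * ?x\<rfloor>"
    have "0 \<le> (1 - \<epsilon>) * ?x" using x \<epsilon> by simp
    then have s: "real s \<le> (1 - \<epsilon>) * ?x" "(1 - \<epsilon>) * ?x - 1 \<le> real s" by (auto simp: s_def)
    have surv: "maker_survives ?H (b n) s"
      using elim b \<epsilon> \<nu> s(1)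
      by (intro maker_survives_connectivity[where \<nu> = \<nu>] maker_threshold_condition[where \<epsilon> = \<epsilon>]) auto
    have "(1 - 2 * \<epsilon>) * ?x \<le> (1 - \<epsilon>) * ?x - 1" using \<open>1 \<le> \<epsilon> * ?x\<close> by (simp add: algebra_simps)
    also have "\<dots> \<le> real (tau ?H (b n))" using s(2) tau_ge[OF elim(4) b surv] by linarith
    finally have lower: "1 - 2 * \<epsilon> \<le> real (tau ?H (b n)) / ?x" using x by (simp add: field_simps)
    have "ln ((real (b n) + 1) ^ tau ?H (b n)) \<le> ln (real n + 1)"
      using tau_le[OF elim(4) b surv] by (subst ln_le_cancel_iff) auto
    then have "real (tau ?H (b n)) * ?\<beta> \<le> ln (real n + 1)" by (simp add: ln_realpow)
    then have "real (tau ?H (b n)) / ?x \<le> ln (real n + 1) / ln (real n)"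
      using \<beta> lnn by (simp add: log_def field_simps)
    with lower show ?case by simp
  qed
qed

theorem corollary1p2:
  fixes b :: "nat \<Rightarrow> nat"
  assumes "\<And>n. b n \<ge> 1"
    and "subpolynomial (\<lambda>n. real (b n))"
  shows "(\<lambda>n. real (tau (connectivity_hypergraph n) (b n)))
           \<sim>[at_top] (\<lambda>n. log (real (b n) + 1) (real n))"
proof (rule asymp_equivI', rule order_tendstoI)
  fix a :: real assume "a < 1"
  \<comment> \<open>The first entry keeps \<open>\<epsilon>\<close> below 1, the second makes 2
    \<open>\<epsilon>\<close> at most (1 - a) / 2.\<close>
  define \<epsilon> where "\<epsilon> = min (1/2) ((1 - a) / 4)"
  have "0 < \<epsilon>" "\<epsilon> < 1" "a < 1 - 2 * \<epsilon>" using \<open>a < 1\<close> by (auto simp: \<epsilon>_def min_def field_simps)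
  from eventually_tau_bounds[OF assms this(1,2)]
  show "eventually (\<lambda>n. a < real (tau (connectivity_hypergraph n) (b n)) / log (real (b n) + 1) (real n)) at_top"
    by (rule eventually_mono) (use \<open>a < 1 - 2 * \<epsilon>\<close> in linarith)
next
  fix a :: real assume "1 < a"
  have "(\<lambda>n. ln (real n + 1) / ln (real n)) \<longlonglongrightarrow> 1" by real_asymp
  then have "eventually (\<lambda>n. ln (real n + 1) / ln (real n) < a) at_top"
    using \<open>1 < a\<close> by (rule order_tendstoD)
  moreover have "eventually (\<lambda>n. real (tau (connectivity_hypergraph n) (b n)) / log (real (b n) + 1) (real n)
      \<le> ln (real n + 1) / ln (real n)) at_top"
    \<comment> \<open>The upper bound does not depend on \<open>\<epsilon>\<close>, so any
      admissible value serves.\<close>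
    using eventually_tau_bounds[OF assms, of "1/2"] by (auto elim: eventually_mono)
  ultimately show "eventually (\<lambda>n. real (tau (connectivity_hypergraph n) (b n)) / log (real (b n) + 1) (real n) < a) at_top"
    by eventually_elim linarith
qed

end
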